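(* For any integer $m\ge 1$, let $\psi:\mathbb{U}_m\times\overline{\mathbb{Q}}(x)\to\mathbb{N}$ be the function defined in the following way: for $\xi\in\mathbb{U}_m$ and $F(x)\in\overline{\mathbb{Q}}(x)$, the number $\psi(\xi,F)$ is defined as the type of the $U$-number $F(\xi)$. Then $\psi^{-1}(s)$ is an infinite set, for any positive integer $s$ (in particular, $\psi$ is a surjective function). Indeed, for any $s\ge 1$, the series $$\sum_{\xi\in\pi_1(\psi^{-1}(s))}\frac{1}{\xi}$$ diverges, where $\pi_1(x,y)=x$ is the projection onto the first coordinate.
   Context: $\mathbb{N}$ is the set of positive integers, $\overline{\mathbb{Q}}$ is the field of algebraic numbers, and $\overline{\mathbb{Q}}(x)$ is the set of rational functions with algebraic coefficients. For an algebraic number $\alpha$, the height $H(\alpha)$ is the maximum of the absolute values of the coefficients of the minimal polynomial of $\alpha$ over $\mathbb{Z}$. For a number $\xi$ and an integer $n\ge 1$, $\omega_n^*(\xi)$ is the supremum of the positive real numbers $\omega^*$ for which there exist infinitely many real algebraic numbers $\alpha$ of degree $n$ satisfying $0<|\xi-\alpha|<H(\alpha)^{-\omega^*-1}$. The number $\xi$ is a $U_m$-number (equivalently, a $U_m^*$-number) if $\omega_m^*(\xi)=\infty$ and $\omega_n^*(\xi)<\infty$ for all $1\le n<m$; $\mathbb{U}_m$ denotes the set of $U_m$-numbers. A $U$-number is a number that is a $U_t$-number for some $t\ge 1$, and this $t$ is called its type.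
   Formalization: ψ is taken as a partial function, defined only at pairs (ξ,F) for which F(ξ) is a U-number: for constant F, or when F(ξ) is not real (e.g. F(x)=ix), F(ξ) is not a U-number and ψ(ξ,F) is undefined; "diverges" means not unconditionally summable. *)

theory Defs
  imports
    "HOL-Analysis.Analysis"
    "HOL-Computational_Algebra.Computational_Algebra"
    "HOL-Computational_Algebra.Field_as_Ring"
begin

text \<open>An irreducible integer polynomial of positive degree is primitive, so for algebraic
  \<open>\<alpha>\<close> this is the unique minimal polynomial over the integers with positive
  leading coefficient.  For transcendental \<open>\<alpha>\<close> the value is unspecified.\<close>

definition min_int_poly :: "'a :: field_char_0 \<Rightarrow> int poly" where
  "min_int_poly \<alpha> =
    (THE p. irreducible p \<and> lead_coeff p > 0 \<and> poly (map_poly of_int p) \<alpha> = 0)"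

definition alg_degree :: "'a :: field_char_0 \<Rightarrow> nat" where
  "alg_degree \<alpha> = degree (min_int_poly \<alpha>)"

definition height :: "'a :: field_char_0 \<Rightarrow> int" where
  "height \<alpha> = Max ((\<lambda>i. \<bar>coeff (min_int_poly \<alpha>) i\<bar>) ` {..alg_degree \<alpha>})"

text \<open>The approximants \<open>\<alpha>\<close> are real, while \<open>\<xi>\<close> is allowed to be complex because
  rational functions with complex algebraic coefficients are evaluated below.  The supremum is
  taken in \<open>[0, \<infinity>]\<close>, so it is \<open>0\<close> if no exponent is admissible.\<close>

definition omega_star :: "nat \<Rightarrow> complex \<Rightarrow> ennreal" where
  "omega_star n \<xi> = (SUP w \<in> {w::real. w > 0 \<and>
      infinite {\<alpha>::real. algebraic \<alpha> \<and> alg_degree \<alpha> = n \<and>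
        0 < cmod (\<xi> - of_real \<alpha>) \<and>
        cmod (\<xi> - of_real \<alpha>) < real_of_int (height \<alpha>) powr (- w - 1)}}. ennreal w)"

definition U_numbers :: "nat \<Rightarrow> complex set" where
  "U_numbers m =
    {\<xi>. m \<ge> 1 \<and> omega_star m \<xi> = \<infinity> \<and> (\<forall>n. 1 \<le> n \<and> n < m \<longrightarrow> omega_star n \<xi> < \<infinity>)}"

definition is_U_number :: "complex \<Rightarrow> bool" where
  "is_U_number \<xi> \<longleftrightarrow> (\<exists>t\<ge>1. \<xi> \<in> U_numbers t)"

definition U_type :: "complex \<Rightarrow> nat" where
  "U_type \<xi> = (THE t. t \<ge> 1 \<and> \<xi> \<in> U_numbers t)"

lemma U_type_eq:
  assumes "\<xi> \<in> U_numbers t"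
  shows "U_type \<xi> = t"
  unfolding U_type_def
proof (rule the_equality)
  show "t \<ge> 1 \<and> \<xi> \<in> U_numbers t"
    using assms by (auto simp: U_numbers_def)
next
  fix s assume "s \<ge> 1 \<and> \<xi> \<in> U_numbers s"
  with assms show "s = t"
    unfolding U_numbers_def by (cases s t rule: linorder_cases) auto
qed

definition alg_ratfuns :: "complex poly fract set" where
  "alg_ratfuns = {Fract p q | p q.
     q \<noteq> 0 \<and> (\<forall>i. algebraic (coeff p i)) \<and> (\<forall>i. algebraic (coeff q i))}"

text \<open>Evaluation in lowest terms; at a pole the value is \<open>0\<close> by convention.  An element
  of \<open>alg_ratfuns\<close> has no pole at a transcendental number.\<close>

definition ratfun_eval :: "complex poly fract \<Rightarrow> complex \<Rightarrow> complex" where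
  "ratfun_eval F z = poly (fst (quot_of_fract F)) z / poly (snd (quot_of_fract F)) z"

lemma ratfun_eval_Fract:
  assumes "poly q z \<noteq> 0"
  shows "ratfun_eval (Fract p q) z = poly p z / poly q z"
proof -
  define a b where "a = fst (quot_of_fract (Fract p q))" and "b = snd (quot_of_fract (Fract p q))"
  have q: "q \<noteq> 0" using assms by auto
  have ab: "quot_of_fract (Fract p q) = (a, b)" by (simp add: a_def b_def)
  have b: "b \<noteq> 0" by (simp add: b_def)
  have cop: "coprime a b" unfolding a_def b_def by (rule coprime_quot_of_fract)
  have "Fract a b = Fract p q"
    unfolding a_def b_def by (rule Fract_quot_of_fract)
  with b q have eq: "a * q = p * b" by (simp add: eq_fract)
  have "b dvd a * q" by (simp add: eq)
  with cop have "b dvd q"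
    by (simp add: coprime_commute coprime_dvd_mult_right_iff)
  with assms have "poly b z \<noteq> 0" by (auto elim!: dvdE)
  moreover have "poly a z * poly q z = poly p z * poly b z"
    using arg_cong[OF eq, of "\<lambda>r. poly r z"] by simp
  ultimately show ?thesis
    using assms unfolding ratfun_eval_def ab by (simp add: field_simps)
qed

text \<open>The function is partial: \<open>F(\<xi>)\<close> need not be a \<open>U\<close>-number (for instance if \<open>F\<close> is
  constant), so the domain consists of the pairs for which the type of \<open>F(\<xi>)\<close> exists.\<close>

definition psi :: "nat \<Rightarrow> complex \<times> complex poly fract \<rightharpoonup> nat" where
  "psi m = (\<lambda>(\<xi>, F).
     if \<xi> \<in> U_numbers m \<and> F \<in> alg_ratfuns \<and> is_U_number (ratfun_eval F \<xi>)
     then Some (U_type (ratfun_eval F \<xi>)) else None)"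

end

theory Submission
  imports Defs "Subresultants.Subresultant_Gcd"
begin

text \<open>Let \<open>l\<close> be one of the Liouville constants \<open>\<Sum>k. 2 ^ - (k + j)!\<close>.  For every nonzero real algebraic
  \<open>\<alpha>\<close> of degree \<open>m\<close> the number \<open>\<alpha> l\<close> is a \<open>U\<close>-number of type \<open>m\<close>: its approximants
  \<open>\<alpha> p\<^sub>k / q\<^sub>k\<close> have degree \<open>m\<close>, and a number \<open>\<beta>\<close> of another degree keeps, by Liouville's
  inequality, a distance from \<open>\<alpha> p\<^sub>k / q\<^sub>k\<close> of at least a negative power of \<open>H(\<beta>) q\<^sub>k\<close>;
  as \<open>q\<^sub>k\<close> grows superexponentially, some \<open>k\<close> with \<open>q\<^sub>k\<close> polynomially bounded in \<open>H(\<beta>)\<close> makes the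
  error \<open>2 / q\<^sub>k\<^sub>+\<^sub>1\<close> negligible.  The map \<open>x \<mapsto> (2\<^bsup>1/s\<^esup> / 2\<^bsup>1/m\<^esup>) x\<close> therefore sends the
  \<open>U\<^sub>m\<close>-number \<open>2\<^bsup>1/m\<^esup> l\<close> to the \<open>U\<^sub>s\<close>-number \<open>2\<^bsup>1/s\<^esup> l\<close>, and varying \<open>j\<close> gives an infinite bounded
  family, so that the terms \<open>1 / \<xi>\<close> do not tend to zero.\<close>

subsection \<open>A lower bound from the resultant\<close>

text \<open>Each row lists, highest power first, the coefficients of a monomial times
  \<open>p\<close> or \<open>q\<close>; pairing it with the descending powers of \<open>x\<close>
  evaluates that product at \<open>x\<close>.\<close>

lemma sylvester_mat_mult_powers:
  fixes p q :: "real poly" and x :: real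
  defines "m \<equiv> degree p" and "n \<equiv> degree q"
  assumes i: "i < m + n"
  shows "(sylvester_mat p q *\<^sub>v vec (m + n) (\<lambda>j. x ^ (m + n - 1 - j))) $ i =
    (if i < n then x ^ (n - 1 - i) * poly p x else x ^ (m + n - 1 - i) * poly q x)"
proof -
  define r where "r = (if i < n then monom 1 (n - 1 - i) * p else monom 1 (m + n - 1 - i) * q)"
  have entry: "sylvester_mat p q $$ (i, j) = coeff r (m + n - 1 - j)" if "j < m + n" for j
    using i that unfolding m_def n_def r_def
    by (subst sylvester_index_mat2) (auto simp: coeff_monom_mult)
  have "degree r \<le> m + n - 1"
    unfolding r_def using i
    by (auto intro!: order.trans[OF degree_mult_le] add_mono degree_monom_le
         simp: m_def n_def degree_monom_eq)
  hence "poly r x = (\<Sum>k<m+n. coeff r k * x ^ k)"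
    using i unfolding poly_altdef
    by (intro sum.mono_neutral_left) (auto simp: coeff_eq_0)
  also have "\<dots> = (\<Sum>j<m+n. coeff r (m + n - Suc j) * x ^ (m + n - Suc j))"
    by (rule sum.nat_diff_reindex [symmetric])
  also have "\<dots> = (sylvester_mat p q *\<^sub>v vec (m + n) (\<lambda>j. x ^ (m + n - 1 - j))) $ i"
    using i entry by (auto simp: scalar_prod_def m_def n_def lessThan_atLeast0 intro!: sum.cong)
  finally show ?thesis
    by (simp add: r_def poly_monom split: if_splits)
qed

text \<open>In the Leibniz expansion every permutation takes exactly one factor from column
  \<open>k\<close> and \<open>N - 1\<close> factors from the other columns.\<close>

lemma abs_det_le_column:
  fixes A :: "real mat"
  assumes A: "A \<in> carrier_mat N N" and k: "k < N"
    and col: "\<And>i. i < N \<Longrightarrow> \<bar>A $$ (i, k)\<bar> \<le> b"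
    and rest: "\<And>i j. i < N \<Longrightarrow> j < N \<Longrightarrow> j \<noteq> k \<Longrightarrow> \<bar>A $$ (i, j)\<bar> \<le> M"
  shows "\<bar>det A\<bar> \<le> fact N * M ^ (N - 1) * b"
proof -
  have prod_le: "\<bar>\<Prod>i = 0..<N. A $$ (i, \<pi> i)\<bar> \<le> M ^ (N - 1) * b"
    if pi: "\<pi> permutes {0..<N}" for \<pi>
  proof -
    from k permutes_surj[OF pi] obtain l where l: "\<pi> l = k" by (metis surjD)
    with k pi have lN: "l < N"
      by (metis atLeastLessThan_iff permutes_not_in zero_le)
    have "\<bar>\<Prod>i = 0..<N. A $$ (i, \<pi> i)\<bar> = \<bar>A $$ (l, k)\<bar> * (\<Prod>i \<in> {0..<N} - {l}. \<bar>A $$ (i, \<pi> i)\<bar>)"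
      using lN l by (simp add: abs_prod abs_mult prod.remove[of _ l])
    also have "\<dots> \<le> b * (\<Prod>i \<in> {0..<N} - {l}. M)"
    proof (intro mult_mono prod_mono prod_nonneg)
      show "0 \<le> b" using col[OF k] by linarith
      fix i assume i: "i \<in> {0..<N} - {l}"
      have "\<pi> i < N" using i permutes_in_image[OF pi, of i] by auto
      moreover have "\<pi> i \<noteq> k" using i l permutes_inj[OF pi] by (auto dest: injD)
      ultimately show "0 \<le> \<bar>A $$ (i, \<pi> i)\<bar> \<and> \<bar>A $$ (i, \<pi> i)\<bar> \<le> M"
        using i rest by auto
    qed (use col lN in auto)
    finally show ?thesis using lN by (simp add: mult.commute)
  qed
  have "\<bar>det A\<bar> \<le> (\<Sum>\<pi> | \<pi> permutes {0..<N}. \<bar>of_int (sign \<pi>) * (\<Prod>i = 0..<N. A $$ (i, \<pi> i))\<bar>)"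
    using A unfolding det_def by (auto intro: sum_abs)
  also have "\<dots> \<le> (\<Sum>\<pi> | \<pi> permutes {0..<N}. M ^ (N - 1) * b)"
  proof (rule sum_mono)
    fix \<pi> assume "\<pi> \<in> {\<pi>. \<pi> permutes {0..<N}}"
    thus "\<bar>of_int (sign \<pi>) * (\<Prod>i = 0..<N. A $$ (i, \<pi> i))\<bar> \<le> M ^ (N - 1) * b"
      using prod_le[of \<pi>] by (auto simp: abs_mult sign_def)
  qed
  also have "\<dots> = fact N * M ^ (N - 1) * b"
    using card_permutations[of "{0..<N}" N] by simp
  finally show ?thesis .
qed

text \<open>Cramer's rule for the Sylvester matrix and the vector of powers of \<open>x\<close>: the only column of the
  replaced matrix that is not bounded by \<open>M\<close> consists of multiples of \<open>q(x)\<close>.\<close>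

lemma resultant_lower_bound:
  fixes p q :: "int poly" and x M K :: real
  assumes res: "resultant p q \<noteq> 0" and root: "poly (of_int_poly p) x = 0"
    and M: "\<And>i. \<bar>of_int (coeff p i)\<bar> \<le> M" "\<And>i. \<bar>of_int (coeff q i)\<bar> \<le> M"
    and K: "\<bar>x\<bar> \<le> K" "1 \<le> K"
    and N: "N = degree p + degree q" "N > 0"
  shows "1 \<le> fact N * M ^ (N - 1) * (K ^ N * \<bar>poly (of_int_poly q) x\<bar>)"
proof -
  define p' q' :: "real poly" where "p' = of_int_poly p" and "q' = of_int_poly q"
  have deg [simp]: "degree p' = degree p" "degree q' = degree q"
    by (simp_all add: p'_def q'_def)
  define S where "S = sylvester_mat p' q'"
  define v where "v = vec N (\<lambda>j. x ^ (N - 1 - j))"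
  define b where "b = S *\<^sub>v v"
  have S: "S \<in> carrier_mat N N" by (simp add: S_def N carrier_matI)
  have M0: "0 \<le> M" using M(1)[of 0] by linarith
  have xpow: "\<bar>x\<bar> ^ k \<le> K ^ N" if "k \<le> N" for k
  proof -
    have "\<bar>x\<bar> ^ k \<le> K ^ k" using K by (intro power_mono) auto
    also have "\<dots> \<le> K ^ N" using K that by (intro power_increasing) auto
    finally show ?thesis .
  qed
  \<comment> \<open>The rows belonging to \<open>p\<close> give multiples of
    \<open>p(x) = 0\<close>; the others give a power of \<open>x\<close> times
    \<open>q(x)\<close>.\<close>
  have b: "\<bar>b $ i\<bar> \<le> K ^ N * \<bar>poly q' x\<bar>" if "i < N" for i
    using sylvester_mat_mult_powers[of i p' q' x] that root xpow[of "N - 1 - i"] K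
    by (auto simp: b_def S_def v_def N p'_def [symmetric] abs_mult power_abs intro!: mult_right_mono)
  have "\<bar>S $$ (i, j)\<bar> \<le> M" if "i < N" "j < N" for i j
    using that M M0 by (auto simp: S_def sylvester_index_mat N p'_def q'_def)
  hence "\<bar>det (replace_col S b (N - 1))\<bar> \<le> fact N * M ^ (N - 1) * (K ^ N * \<bar>poly q' x\<bar>)"
    using b N S by (intro abs_det_le_column[of _ N "N - 1"]) (auto simp: replace_col_def)
  \<comment> \<open>The last column is chosen because the last entry of \<open>v\<close> is
    \<open>x ^ 0 = 1\<close>, so that Cramer's rule yields the resultant itself. Being a nonzero
    integer, it is at least 1 in absolute value.\<close>
  also have "det (replace_col S b (N - 1)) = v $ (N - 1) * det S"
    unfolding b_def using N by (intro cramer_lemma_mat[OF S]) (auto simp: v_def)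
  also have "\<dots> = det S" using N by (simp add: v_def)
  also have "\<dots> = of_int (resultant p q)"
    unfolding S_def p'_def q'_def resultant_def [symmetric]
    by (rule of_int_hom.resultant_hom)
  finally have "real_of_int \<bar>resultant p q\<bar> \<le> fact N * M ^ (N - 1) * (K ^ N * \<bar>poly q' x\<bar>)"
    by simp
  moreover have "1 \<le> real_of_int \<bar>resultant p q\<bar>" using res by linarith
  ultimately show ?thesis unfolding q'_def by linarith
qed

subsection \<open>Minimal polynomials and heights of real algebraic numbers\<close>

lemma coeff_bound_exists:
  fixes p q :: "int poly"
  obtains M :: real where "\<And>i. \<bar>of_int (coeff p i)\<bar> \<le> M" "\<And>i. \<bar>of_int (coeff q i)\<bar> \<le> M"
proof -
  have bound: "\<bar>real_of_int (coeff r i)\<bar> \<le> (\<Sum>i\<le>degree r. \<bar>of_int (coeff r i)\<bar>)" for r :: "int poly" and i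
  proof (cases "i \<le> degree r")
    case True
    thus ?thesis by (intro member_le_sum) auto
  next
    case False
    thus ?thesis by (simp add: coeff_eq_0 sum_nonneg)
  qed
  show ?thesis
    by (rule that[of "max (\<Sum>i\<le>degree p. \<bar>of_int (coeff p i)\<bar>) (\<Sum>i\<le>degree q. \<bar>of_int (coeff q i)\<bar>)"])
       (use bound in \<open>auto simp: le_max_iff_disj\<close>)
qed

text \<open>The gcd is a proper divisor of the irreducible \<open>p\<close>, hence a unit, whereas a
  vanishing resultant requires a gcd of positive degree.\<close>

lemma resultant_irreducible_nonzero:
  fixes p q :: "int poly"
  assumes "irreducible p" "\<not> p dvd q"
  shows "resultant p q \<noteq> 0"
proof -
  have "\<not> p dvd gcd p q" using assms by auto
  hence "gcd p q dvd 1" using assms(1) unfolding irreducible_altdef by (metis gcd_dvd1)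
  hence "degree (gcd p q) = 0" by (auto simp: is_unit_poly_iff)
  thus ?thesis by (simp add: resultant_0_gcd)
qed

text \<open>Otherwise the resultant is nonzero, and \<open>resultant_lower_bound\<close> is violated
  by \<open>q(x) = 0\<close>. This gives divisibility over the integers directly, without a passage
  through rational polynomials.\<close>

lemma irreducible_dvd_of_common_root:
  fixes p q :: "int poly" and x :: real
  assumes "irreducible p" "poly (of_int_poly p) x = 0" "poly (of_int_poly q) x = 0"
  shows "p dvd q"
proof (rule ccontr)
  assume "\<not> p dvd q"
  hence res: "resultant p q \<noteq> 0" by (rule resultant_irreducible_nonzero[OF assms(1)])
  have "degree p > 0"
  proof (rule ccontr)
    assume "\<not> degree p > 0"
    then obtain c where "p = [:c:]" by (auto elim: degree_eq_zeroE)
    thus False using assms(1,2) by (cases "c = 0") auto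
  qed
  moreover obtain M where "\<And>i. \<bar>real_of_int (coeff p i)\<bar> \<le> M" "\<And>i. \<bar>real_of_int (coeff q i)\<bar> \<le> M"
    using coeff_bound_exists[of p q] by blast
  ultimately show False
    using resultant_lower_bound[OF res assms(2), of M "max 1 \<bar>x\<bar>"] assms(3) by auto
qed

text \<open>Some prime factor of \<open>p\<close> must vanish at \<open>\<alpha>\<close>; a change
  of sign makes its leading coefficient positive.\<close>

lemma irreducible_int_poly_exists:
  fixes \<alpha> :: real and p :: "int poly"
  assumes "p \<noteq> 0" "poly (of_int_poly p) \<alpha> = 0"
  obtains q :: "int poly" where "irreducible q" "lead_coeff q > 0" "poly (of_int_poly q) \<alpha> = 0"
proof -
  have "\<exists>q. irreducible q \<and> poly (of_int_poly q) \<alpha> = 0"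
    using assms
  proof (induction p rule: prime_divisors_induct)
    case (unit p)
    then obtain c where "p = [:c:]" by (auto simp: is_unit_poly_iff)
    with unit.prems show ?case by auto
  next
    case (factor q p)
    show ?case
    proof (cases "poly (of_int_poly q) \<alpha> = 0")
      case True
      thus ?thesis using factor.hyps by (auto intro!: exI[of _ q] prime_elem_imp_irreducible)
    next
      case False
      thus ?thesis using factor.prems factor.IH by (auto simp: of_int_poly_hom.hom_mult)
    qed
  qed auto
  then obtain q where q: "irreducible q" "poly (of_int_poly q) \<alpha> = 0" by blast
  show ?thesis
  proof (cases "lead_coeff q > 0")
    case True
    with q show ?thesis by (intro that)
  next
    case False
    have "lead_coeff q \<noteq> 0" using q(1) by auto
    moreover have "lead_coeff (- q) = - lead_coeff q" by simp
    ultimately have "lead_coeff (- q) > 0" using False by linarith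
    moreover have "irreducible (- q)"
      using q(1) irreducible_mult_unit_left[of "-1" q] by simp
    moreover have "poly (of_int_poly (- q)) \<alpha> = 0" using q(2) by (simp add: of_int_poly_hom.hom_uminus)
    ultimately show ?thesis by (intro that)
  qed
qed

text \<open>The two polynomials divide each other, and a positive leading coefficient singles out
  one of the associates.\<close>

lemma min_int_poly_unique:
  fixes \<alpha> :: real and p q :: "int poly"
  assumes "irreducible p" "lead_coeff p > 0" "poly (of_int_poly p) \<alpha> = 0"
    and "irreducible q" "lead_coeff q > 0" "poly (of_int_poly q) \<alpha> = 0"
  shows "p = q"
proof -
  have "p dvd q" "q dvd p" using assms by (auto intro: irreducible_dvd_of_common_root)
  moreover have "normalize p = p" "normalize q = q"
    using assms by (auto simp: normalize_poly_def unit_factor_int_def sgn_if pCons_one)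
  ultimately show ?thesis by (metis associated_eqI)
qed

lemma algebraic_int_polyE:
  fixes \<alpha> :: real
  assumes "algebraic \<alpha>"
  obtains p :: "int poly" where "p \<noteq> 0" "poly (of_int_poly p) \<alpha> = 0"
  using assms by (metis algebraicE')

lemma algebraic_int_polyI:
  fixes p :: "int poly"
  assumes "p \<noteq> 0" "poly (of_int_poly p) \<alpha> = 0"
  shows "algebraic \<alpha>"
  using assms by (intro algebraicI[of "of_int_poly p"]) auto

lemma min_int_poly:
  fixes \<alpha> :: real
  assumes "algebraic \<alpha>"
  shows irreducible_min_int_poly: "irreducible (min_int_poly \<alpha>)"
    and lead_coeff_min_int_poly: "lead_coeff (min_int_poly \<alpha>) > 0"
    and poly_min_int_poly: "poly (of_int_poly (min_int_poly \<alpha>)) \<alpha> = 0"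
proof -
  obtain p :: "int poly" where p: "irreducible p" "lead_coeff p > 0" "poly (of_int_poly p) \<alpha> = 0"
    using assms by (metis algebraic_int_polyE irreducible_int_poly_exists)
  have "irreducible (min_int_poly \<alpha>) \<and> lead_coeff (min_int_poly \<alpha>) > 0 \<and>
      poly (of_int_poly (min_int_poly \<alpha>)) \<alpha> = 0"
    unfolding min_int_poly_def
    by (rule theI[of _ p]) (use p min_int_poly_unique in blast)+
  thus "irreducible (min_int_poly \<alpha>)" "lead_coeff (min_int_poly \<alpha>) > 0"
    "poly (of_int_poly (min_int_poly \<alpha>)) \<alpha> = 0" by auto
qed

lemma min_int_poly_dvd:
  fixes \<alpha> :: real
  assumes "algebraic \<alpha>" "poly (of_int_poly p) \<alpha> = 0"
  shows "min_int_poly \<alpha> dvd p"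
  using assms by (intro irreducible_dvd_of_common_root) (auto simp: min_int_poly)

lemma alg_degree_le:
  fixes \<alpha> :: real
  assumes "p \<noteq> 0" "poly (of_int_poly p) \<alpha> = 0"
  shows "alg_degree \<alpha> \<le> degree p"
  unfolding alg_degree_def
  by (intro dvd_imp_degree_le min_int_poly_dvd algebraic_int_polyI[of p] assms)

lemma alg_degree_pos:
  fixes \<alpha> :: real
  assumes "algebraic \<alpha>"
  shows "alg_degree \<alpha> > 0"
proof (rule ccontr)
  assume "\<not> alg_degree \<alpha> > 0"
  then obtain c where "min_int_poly \<alpha> = [:c:]" by (auto simp: alg_degree_def elim: degree_eq_zeroE)
  thus False using min_int_poly[OF assms] by auto
qed

lemma abs_coeff_le_height: "\<bar>coeff (min_int_poly \<alpha>) i\<bar> \<le> height \<alpha>"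
proof (cases "i \<le> alg_degree \<alpha>")
  case True
  thus ?thesis unfolding height_def by (intro Max_ge) auto
next
  case False
  have "0 \<le> \<bar>coeff (min_int_poly \<alpha>) 0\<bar>" by simp
  also have "\<dots> \<le> height \<alpha>" unfolding height_def by (intro Max_ge) auto
  finally show ?thesis using False by (simp add: alg_degree_def coeff_eq_0)
qed

lemma height_ge_1:
  fixes \<alpha> :: real
  assumes "algebraic \<alpha>"
  shows "height \<alpha> \<ge> 1"
  using lead_coeff_min_int_poly[OF assms] abs_coeff_le_height[of \<alpha> "degree (min_int_poly \<alpha>)"] by linarith

text \<open>By the degree condition \<open>p\<close> is a nonzero integer times the minimal
  polynomial, and such a factor cannot shrink coefficients.\<close>

lemma height_le:
  fixes \<alpha> :: real
  assumes p: "p \<noteq> 0" "poly (of_int_poly p) \<alpha> = 0" "degree p = alg_degree \<alpha>"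
    and B: "\<And>i. \<bar>coeff p i\<bar> \<le> B"
  shows "height \<alpha> \<le> B"
proof -
  have alg: "algebraic \<alpha>" using p by (blast intro: algebraic_int_polyI)
  from min_int_poly_dvd[OF alg p(2)] obtain c where c: "p = min_int_poly \<alpha> * c" by blast
  have "degree p = alg_degree \<alpha> + degree c"
    using p(1) unfolding c alg_degree_def by (intro degree_mult_eq) auto
  with p(3) obtain a where a: "c = [:a:]" by (auto elim: degree_eq_zeroE)
  have "a \<noteq> 0" using p(1) a c by auto
  have "\<bar>coeff (min_int_poly \<alpha>) i\<bar> \<le> B" for i
  proof -
    have "\<bar>coeff (min_int_poly \<alpha>) i\<bar> * 1 \<le> \<bar>coeff (min_int_poly \<alpha>) i\<bar> * \<bar>a\<bar>"
      using \<open>a \<noteq> 0\<close> by (intro mult_left_mono) auto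
    also have "\<dots> = \<bar>coeff p i\<bar>" by (simp add: c a abs_mult mult.commute)
    also have "\<dots> \<le> B" by (rule B)
    finally show ?thesis by simp
  qed
  thus ?thesis unfolding height_def by (subst Max_le_iff) auto
qed

section \<open>Northcott finiteness\<close>

lemma finite_bounded_int_polys:
  "finite {p :: int poly. degree p \<le> n \<and> (\<forall>i. \<bar>coeff p i\<bar> \<le> B)}"
proof -
  have "{p :: int poly. degree p \<le> n \<and> (\<forall>i. \<bar>coeff p i\<bar> \<le> B)} \<subseteq>
      Poly ` {xs. set xs \<subseteq> {-B..B} \<and> length xs \<le> Suc n}"
  proof
    fix p :: "int poly" assume p: "p \<in> {p. degree p \<le> n \<and> (\<forall>i. \<bar>coeff p i\<bar> \<le> B)}"
    have "set (coeffs p) \<subseteq> range (coeff p)" by (auto simp: range_coeff)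
    also have "\<dots> \<subseteq> {-B..B}" using p by (auto simp: abs_le_iff minus_le_iff)
    finally have "set (coeffs p) \<subseteq> {-B..B}" .
    moreover have "length (coeffs p) \<le> Suc n"
      using p by (cases "p = 0") (auto simp: length_coeffs_degree)
    ultimately show "p \<in> Poly ` {xs. set xs \<subseteq> {-B..B} \<and> length xs \<le> Suc n}"
      by (metis (mono_tags, lifting) Poly_coeffs image_eqI mem_Collect_eq)
  qed
  thus ?thesis by (rule finite_subset) (intro finite_imageI finite_lists_length_le, simp)
qed

text \<open>Bounded degree and height leave finitely many minimal polynomials, each with finitely
  many roots.\<close>

lemma finite_bounded_height:
  "finite {\<alpha> :: real. algebraic \<alpha> \<and> alg_degree \<alpha> = n \<and> height \<alpha> \<le> B}"
proof (rule finite_subset)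
  let ?P = "{p :: int poly. degree p \<le> n \<and> (\<forall>i. \<bar>coeff p i\<bar> \<le> B)} - {0}"
  show "{\<alpha> :: real. algebraic \<alpha> \<and> alg_degree \<alpha> = n \<and> height \<alpha> \<le> B} \<subseteq>
      (\<Union>p\<in>?P. {x. poly (of_int_poly p) x = 0})"
  proof
    fix \<alpha> :: real assume a: "\<alpha> \<in> {\<alpha>. algebraic \<alpha> \<and> alg_degree \<alpha> = n \<and> height \<alpha> \<le> B}"
    hence "min_int_poly \<alpha> \<in> ?P"
      using order.trans[OF abs_coeff_le_height] lead_coeff_min_int_poly[of \<alpha>]
      by (auto simp: alg_degree_def)
    with a show "\<alpha> \<in> (\<Union>p\<in>?P. {x. poly (of_int_poly p) x = 0})"
      using poly_min_int_poly[of \<alpha>] by blast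
  qed
  show "finite (\<Union>p\<in>?P. {x :: real. poly (of_int_poly p) x = 0})"
    by (intro finite_UN_I finite_Diff finite_bounded_int_polys poly_roots_finite) auto
qed

subsection \<open>Liouville's inequality\<close>

text \<open>The polynomial is \<open>a ^ m * p (b X / a)\<close> with \<open>m = degree p\<close>:
  the factor \<open>a ^ m\<close> clears the denominators.\<close>

lemma scaled_int_poly:
  fixes \<alpha> :: real and p :: "int poly" and a b :: int
  assumes p: "p \<noteq> 0" "poly (of_int_poly p) \<alpha> = 0" and ab: "a \<noteq> 0" "b \<noteq> 0"
  obtains q :: "int poly"
    where "q \<noteq> 0" "degree q = degree p" "poly (of_int_poly q) (\<alpha> * (of_int a / of_int b)) = 0"
      "\<And>i. \<bar>coeff q i\<bar> \<le> \<bar>coeff p i\<bar> * max \<bar>a\<bar> \<bar>b\<bar> ^ degree p"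
proof -
  define m where "m = degree p"
  define q where "q = (\<Sum>i\<le>m. monom (coeff p i * a ^ (m - i) * b ^ i) i)"
  have coeff_q: "coeff q i = (if i \<le> m then coeff p i * a ^ (m - i) * b ^ i else 0)" for i
    by (simp add: q_def coeff_sum)
  have lead: "coeff q m \<noteq> 0" using p ab by (simp add: coeff_q m_def)
  moreover have "degree q \<le> m" by (rule degree_le) (simp add: coeff_q)
  ultimately have deg: "degree q = m" by (metis le_degree order.antisym)
  have "poly (of_int_poly q) (\<alpha> * (of_int a / of_int b)) =
      (\<Sum>i\<le>m. of_int (coeff p i) * of_int a ^ (m - i) * of_int b ^ i * (\<alpha> * (of_int a / of_int b)) ^ i)"
    by (simp add: poly_altdef deg coeff_q)
  also have "\<dots> = (\<Sum>i\<le>m. of_int a ^ m * (of_int (coeff p i) * \<alpha> ^ i))"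
  proof (rule sum.cong)
    fix i assume "i \<in> {..m}"
    hence "real_of_int a ^ m = of_int a ^ (m - i) * of_int a ^ i"
      by (simp flip: power_add)
    thus "of_int (coeff p i) * of_int a ^ (m - i) * of_int b ^ i * (\<alpha> * (of_int a / of_int b)) ^ i =
        of_int a ^ m * (of_int (coeff p i) * \<alpha> ^ i)"
      using ab by (simp add: power_mult_distrib power_divide)
  qed simp
  also have "\<dots> = of_int a ^ m * poly (of_int_poly p) \<alpha>"
    by (simp add: poly_altdef m_def sum_distrib_left)
  finally have root: "poly (of_int_poly q) (\<alpha> * (of_int a / of_int b)) = 0" using p by simp
  have "\<bar>coeff q i\<bar> \<le> \<bar>coeff p i\<bar> * max \<bar>a\<bar> \<bar>b\<bar> ^ m" for i
  proof (cases "i \<le> m")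
    case True
    have "\<bar>coeff q i\<bar> = \<bar>coeff p i\<bar> * (\<bar>a\<bar> ^ (m - i) * \<bar>b\<bar> ^ i)"
      using True by (simp add: coeff_q abs_mult power_abs)
    also have "\<dots> \<le> \<bar>coeff p i\<bar> * (max \<bar>a\<bar> \<bar>b\<bar> ^ (m - i) * max \<bar>a\<bar> \<bar>b\<bar> ^ i)"
      by (intro mult_left_mono mult_mono power_mono) auto
    also have "max \<bar>a\<bar> \<bar>b\<bar> ^ (m - i) * max \<bar>a\<bar> \<bar>b\<bar> ^ i = max \<bar>a\<bar> \<bar>b\<bar> ^ m"
      using True by (simp flip: power_add)
    finally show ?thesis .
  qed (simp add: coeff_q)
  with lead deg root show ?thesis
    by (intro that[of q]) (auto simp: m_def)
qed

lemma scaled_algebraic: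
  fixes \<alpha> :: real and a b :: int
  assumes alg: "algebraic \<alpha>" and ab: "a \<noteq> 0" "b \<noteq> 0"
  shows algebraic_scaled: "algebraic (\<alpha> * (of_int a / of_int b))"
    and alg_degree_scaled: "alg_degree (\<alpha> * (of_int a / of_int b)) = alg_degree \<alpha>"
    and height_scaled: "height (\<alpha> * (of_int a / of_int b)) \<le> height \<alpha> * max \<bar>a\<bar> \<bar>b\<bar> ^ alg_degree \<alpha>"
proof -
  define \<alpha>' where "\<alpha>' = \<alpha> * (of_int a / of_int b)"
  have nz: "min_int_poly \<alpha> \<noteq> 0" using lead_coeff_min_int_poly[OF alg] by auto
  obtain q :: "int poly" where q: "q \<noteq> 0" "degree q = degree (min_int_poly \<alpha>)"
    "poly (of_int_poly q) \<alpha>' = 0"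
    "\<And>i. \<bar>coeff q i\<bar> \<le> \<bar>coeff (min_int_poly \<alpha>) i\<bar> * max \<bar>a\<bar> \<bar>b\<bar> ^ degree (min_int_poly \<alpha>)"
    using scaled_int_poly[OF nz poly_min_int_poly[OF alg] ab] unfolding \<alpha>'_def by metis
  have alg': "algebraic \<alpha>'" by (rule algebraic_int_polyI[OF q(1,3)])
  have nz': "min_int_poly \<alpha>' \<noteq> 0" using lead_coeff_min_int_poly[OF alg'] by auto
  \<comment> \<open>Scaling back by \<open>b / a\<close> gives the reverse inequality between the
    degrees.\<close>
  obtain r :: "int poly" where r: "r \<noteq> 0" "degree r = degree (min_int_poly \<alpha>')"
    "poly (of_int_poly r) (\<alpha>' * (of_int b / of_int a)) = 0"
    using scaled_int_poly[OF nz' poly_min_int_poly[OF alg'] ab(2,1)] by metis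
  have "\<alpha>' * (of_int b / of_int a) = \<alpha>" using ab by (simp add: \<alpha>'_def)
  hence "alg_degree \<alpha> \<le> alg_degree \<alpha>'"
    using alg_degree_le[OF r(1), of \<alpha>] r(2,3) by (simp add: alg_degree_def)
  moreover have "alg_degree \<alpha>' \<le> alg_degree \<alpha>"
    using alg_degree_le[OF q(1,3)] q(2) by (simp add: alg_degree_def)
  ultimately have deg: "alg_degree \<alpha>' = alg_degree \<alpha>" by simp
  have "height \<alpha>' \<le> height \<alpha> * max \<bar>a\<bar> \<bar>b\<bar> ^ alg_degree \<alpha>"
  proof (rule height_le[OF q(1,3)])
    show "degree q = alg_degree \<alpha>'" using q(2) deg by (simp add: alg_degree_def)
    show "\<bar>coeff q i\<bar> \<le> height \<alpha> * max \<bar>a\<bar> \<bar>b\<bar> ^ alg_degree \<alpha>" for i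
      using q(4)[of i] abs_coeff_le_height[of \<alpha> i] unfolding alg_degree_def
      by (meson mult_right_mono order.trans zero_le_power abs_ge_zero max.coboundedI1)
  qed
  with alg' deg show "algebraic (\<alpha> * (of_int a / of_int b))"
    "alg_degree (\<alpha> * (of_int a / of_int b)) = alg_degree \<alpha>"
    "height (\<alpha> * (of_int a / of_int b)) \<le> height \<alpha> * max \<bar>a\<bar> \<bar>b\<bar> ^ alg_degree \<alpha>"
    unfolding \<alpha>'_def by auto
qed

lemma abs_poly_le:
  fixes p :: "real poly"
  assumes "\<And>i. \<bar>coeff p i\<bar> \<le> M" "\<bar>x\<bar> \<le> K" "1 \<le> K" "degree p \<le> n"
  shows "\<bar>poly p x\<bar> \<le> of_nat (Suc n) * (M * K ^ n)"
proof -
  have "\<bar>poly p x\<bar> \<le> (\<Sum>i\<le>degree p. \<bar>coeff p i * x ^ i\<bar>)"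
    unfolding poly_altdef by (rule sum_abs)
  also have "\<dots> \<le> (\<Sum>i\<le>degree p. M * K ^ n)"
  proof (rule sum_mono)
    fix i assume "i \<in> {..degree p}"
    hence "\<bar>x\<bar> ^ i \<le> K ^ n"
      using assms by (meson abs_ge_zero atMost_iff order.trans power_increasing power_mono)
    thus "\<bar>coeff p i * x ^ i\<bar> \<le> M * K ^ n"
      using assms(1)[of i] by (auto simp: abs_mult power_abs intro!: mult_mono)
  qed
  also have "\<dots> = of_nat (Suc (degree p)) * (M * K ^ n)" by simp
  also have "\<dots> \<le> of_nat (Suc n) * (M * K ^ n)"
  proof (rule mult_right_mono)
    have "0 \<le> M" using assms(1)[of 0] by linarith
    thus "0 \<le> M * K ^ n" using assms by simp
  qed (use assms in simp)
  finally show ?thesis .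
qed

text \<open>Mean value theorem, with \<open>abs_poly_le\<close> applied to the derivative, whose
  coefficients are at most \<open>n * M\<close>.\<close>

lemma abs_poly_diff_le:
  fixes p :: "real poly"
  assumes "\<And>i. \<bar>coeff p i\<bar> \<le> M" "\<bar>x\<bar> \<le> K" "\<bar>y\<bar> \<le> K" "1 \<le> K" "degree p \<le> n"
  shows "\<bar>poly p x - poly p y\<bar> \<le> \<bar>x - y\<bar> * (of_nat (Suc n) * (of_nat n * M * K ^ n))"
proof -
  obtain z where z: "z \<in> {-K..K}" "poly p x - poly p y = (x - y) * poly (pderiv p) z"
    using poly_MVT'[of y x "{-K..K}" p] assms by (force simp: abs_le_iff)
  have M: "0 \<le> M" using assms(1)[of 0] by linarith
  have "\<bar>coeff (pderiv p) i\<bar> \<le> of_nat n * M" for i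
  proof (cases "Suc i \<le> n")
    case True
    thus ?thesis using assms(1)[of "Suc i"]
      by (auto simp: coeff_pderiv abs_mult intro!: mult_mono)
  next
    case False
    thus ?thesis using assms(5) M by (simp add: coeff_pderiv coeff_eq_0)
  qed
  hence "\<bar>poly (pderiv p) z\<bar> \<le> of_nat (Suc n) * (of_nat n * M * K ^ n)"
    using z assms by (intro abs_poly_le) (auto simp: degree_pderiv)
  thus ?thesis unfolding z(2) abs_mult by (intro mult_left_mono) auto
qed

text \<open>Different degrees make the minimal polynomials coprime, so the resultant keeps the
  minimal polynomial of \<open>\<beta>\<close> away from 0 at \<open>\<alpha>\<close>. As it
  vanishes at \<open>\<beta>\<close>, the mean value theorem turns this into a distance. The
  constant depends on \<open>m\<close>, \<open>n\<close> and \<open>K\<close> only.\<close>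

lemma liouville_inequality:
  fixes K :: real
  assumes mn: "m \<noteq> n" and K: "1 \<le> K"
  obtains C :: real where "C \<ge> 1"
    "\<And>\<alpha> \<beta> M :: real. \<lbrakk>algebraic \<alpha>; alg_degree \<alpha> = m; algebraic \<beta>; alg_degree \<beta> = n;
       \<bar>\<alpha>\<bar> \<le> K; \<bar>\<beta>\<bar> \<le> K; height \<alpha> \<le> M; height \<beta> \<le> M\<rbrakk> \<Longrightarrow> 1 \<le> C * M ^ (m + n) * \<bar>\<alpha> - \<beta>\<bar>"
proof -
  define N where "N = m + n"
  define C :: real where "C = fact N * K ^ N * (of_nat (Suc n) * (of_nat n * K ^ n))"
  have bound: "1 \<le> C * M ^ N * \<bar>\<alpha> - \<beta>\<bar>"
    if a: "algebraic \<alpha>" "alg_degree \<alpha> = m" and b: "algebraic \<beta>" "alg_degree \<beta> = n"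
      and le: "\<bar>\<alpha>\<bar> \<le> K" "\<bar>\<beta>\<bar> \<le> K" "height \<alpha> \<le> M" "height \<beta> \<le> M" for \<alpha> \<beta> M :: real
  proof -
    let ?p = "min_int_poly \<alpha>" and ?q = "min_int_poly \<beta>"
    have N: "N = degree ?p + degree ?q" "N > 0"
      using a b alg_degree_pos[of \<alpha>] by (auto simp: N_def alg_degree_def)
    have "\<not> ?p dvd ?q"
    proof
      assume "?p dvd ?q"
      hence "poly (of_int_poly ?q) \<alpha> = 0"
        using poly_min_int_poly[OF a(1)] by (auto simp: of_int_poly_hom.hom_mult)
      moreover from this have "?q dvd ?p"
        by (intro irreducible_dvd_of_common_root[where x = \<alpha>] irreducible_min_int_poly poly_min_int_poly a b)
      ultimately have "degree ?p = degree ?q"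
        using \<open>?p dvd ?q\<close> irreducible_min_int_poly[OF a(1)] irreducible_min_int_poly[OF b(1)]
        by (intro order.antisym dvd_imp_degree_le) auto
      thus False using mn a b by (simp add: alg_degree_def)
    qed
    hence res: "resultant ?p ?q \<noteq> 0"
      using a by (intro resultant_irreducible_nonzero irreducible_min_int_poly)
    have coeffs: "\<bar>of_int (coeff ?p i)\<bar> \<le> M" "\<bar>of_int (coeff ?q i)\<bar> \<le> M" for i
      using abs_coeff_le_height[of \<alpha> i] abs_coeff_le_height[of \<beta> i] le by linarith+
    have M: "0 \<le> M" using coeffs(1)[of 0] by linarith
    have "1 \<le> fact N * M ^ (N - 1) * (K ^ N * \<bar>poly (of_int_poly ?q) \<alpha>\<bar>)"
      by (rule resultant_lower_bound[OF res poly_min_int_poly[OF a(1)] coeffs le(1) K N])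
    also have "\<bar>poly (of_int_poly ?q) \<alpha>\<bar> = \<bar>poly (of_int_poly ?q) \<alpha> - poly (of_int_poly ?q) \<beta>\<bar>"
      using poly_min_int_poly[OF b(1)] by simp
    also have "fact N * M ^ (N - 1) * (K ^ N * \<dots>) \<le> fact N * M ^ (N - 1) * (K ^ N *
        (\<bar>\<alpha> - \<beta>\<bar> * (of_nat (Suc n) * (of_nat n * M * K ^ n))))"
      using coeffs le K M b
      by (intro mult_left_mono abs_poly_diff_le) (auto simp: alg_degree_def)
    also have "\<dots> = C * (M * M ^ (N - 1)) * \<bar>\<alpha> - \<beta>\<bar>" by (simp add: C_def mult_ac)
    \<comment> \<open>The extra factor \<open>M\<close> stems from the derivative bound.\<close>
    also have "M * M ^ (N - 1) = M ^ N" using N by (simp flip: power_Suc)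
    finally show ?thesis .
  qed
  show ?thesis
  \<comment> \<open>The maximum secures a constant of at least 1; \<open>C\<close> itself is 0 when
    \<open>n = 0\<close>.\<close>
  proof (rule that[of "max 1 C"])
    fix \<alpha> \<beta> M :: real
    assume *: "algebraic \<alpha>" "alg_degree \<alpha> = m" "algebraic \<beta>" "alg_degree \<beta> = n"
       "\<bar>\<alpha>\<bar> \<le> K" "\<bar>\<beta>\<bar> \<le> K" "height \<alpha> \<le> M" "height \<beta> \<le> M"
    have "0 \<le> M" using *(7) height_ge_1[OF *(1)] by linarith
    hence "C * M ^ (m + n) * \<bar>\<alpha> - \<beta>\<bar> \<le> max 1 C * M ^ (m + n) * \<bar>\<alpha> - \<beta>\<bar>"
      by (intro mult_right_mono) auto
    with bound[OF *] show "1 \<le> max 1 C * M ^ (m + n) * \<bar>\<alpha> - \<beta>\<bar>"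
      unfolding N_def by linarith
  qed simp
qed

subsection \<open>Multiples of rapidly approximable numbers\<close>

text \<open>The least \<open>k \<ge> 2 E\<close> with a large enough gap works: failure at \<open>k - 1\<close> bounds \<open>q k\<close> by
  \<open>G (H q\<^sub>k\<^sub>-\<^sub>1)\<^sup>E\<close>, where \<open>q\<^sub>k\<^sub>-\<^sub>1\<^sup>E\<close> is at most the square root of \<open>q k\<close>.\<close>

lemma superexponential_gap:
  fixes q :: "nat \<Rightarrow> real"
  assumes q2: "\<And>k. 2 \<le> q k" and growth: "\<And>k. q k ^ Suc k \<le> q (Suc k)" and G: "1 \<le> G"
  obtains Q where "1 \<le> Q"
    "\<And>H. 1 \<le> H \<Longrightarrow> \<exists>k. G * (H * q k) ^ E \<le> q (Suc k) \<and> q k \<le> Q * H ^ (2 * E)"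
\<comment> \<open>\<open>q (2 * E)\<close> serves when the least index is \<open>2 * E\<close>
  itself, \<open>G ^ 2\<close> when its predecessor has failed.\<close>
proof (rule that[of "max (q (2 * E)) (G ^ 2)"])
  show "1 \<le> max (q (2 * E)) (G ^ 2)" using q2[of "2 * E"] by linarith
  fix H :: real assume H: "1 \<le> H"
  define P where "P k \<longleftrightarrow> 2 * E \<le> k \<and> G * (H * q k) ^ E \<le> q (Suc k)" for k
  have "\<exists>k. P k"
  proof -
    \<comment> \<open>\<open>q k ^ j\<close> absorbs the constant, and \<open>k = 2 * E + j\<close>
      ensures \<open>j + E \<le> Suc k\<close>.\<close>
    obtain j where j: "G * H ^ E < 2 ^ j" using real_arch_pow[of 2] by auto
    define k where "k = 2 * E + j"
    have q1: "1 \<le> q k" using q2[of k] by linarith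
    have "G * (H * q k) ^ E = G * H ^ E * q k ^ E" by (simp add: power_mult_distrib)
    also have "\<dots> \<le> 2 ^ j * q k ^ E" using j q1 by (intro mult_right_mono) auto
    also have "\<dots> \<le> q k ^ j * q k ^ E" using q2[of k] by (intro mult_right_mono power_mono) auto
    also have "\<dots> = q k ^ (j + E)" by (simp add: power_add)
    also have "\<dots> \<le> q k ^ Suc k" using q1 by (intro power_increasing) (auto simp: k_def)
    also have "\<dots> \<le> q (Suc k)" by (rule growth)
    finally have "P k" by (simp add: P_def k_def)
    thus ?thesis ..
  qed
  define k where "k = (LEAST k. P k)"
  have Pk: "P k" unfolding k_def using \<open>\<exists>k. P k\<close> by (rule LeastI_ex)
  have "q k \<le> max (q (2 * E)) (G ^ 2) * H ^ (2 * E)"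
  proof (cases "k = 2 * E")
    case True
    have "q k * 1 \<le> max (q (2 * E)) (G ^ 2) * H ^ (2 * E)"
      using H q2[of k] by (intro mult_mono) (auto simp: True)
    thus ?thesis by simp
  next
    case False
    with Pk obtain j where j: "k = Suc j" "2 * E \<le> j" by (cases k) (auto simp: P_def)
    have qj: "1 \<le> q j" using q2[of j] by linarith
    have qk: "0 < q k" using q2[of k] by linarith
    have "\<not> P j" using not_less_Least[of j P] j by (simp add: k_def)
    hence lt: "q k < G * (H * q j) ^ E" using j by (simp add: P_def)
    have "q k ^ 2 \<le> (G * (H * q j) ^ E) ^ 2" using lt qk by (intro power_mono) auto
    also have "\<dots> = G ^ 2 * H ^ (2 * E) * q j ^ (2 * E)"
      by (simp add: power_mult_distrib mult.commute flip: power_mult)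
    also have "\<dots> \<le> G ^ 2 * H ^ (2 * E) * q k"
    proof (rule mult_left_mono)
      have "q j ^ (2 * E) \<le> q j ^ Suc j" using qj j by (intro power_increasing) auto
      also have "\<dots> \<le> q k" unfolding j by (rule growth)
      finally show "q j ^ (2 * E) \<le> q k" .
    qed (use G H in simp)
    finally have "q k \<le> G ^ 2 * H ^ (2 * E)" using qk by (simp add: power2_eq_square)
    also have "\<dots> \<le> max (q (2 * E)) (G ^ 2) * H ^ (2 * E)"
      using H by (intro mult_right_mono) auto
    finally show ?thesis .
  qed
  with Pk show "\<exists>k. G * (H * q k) ^ E \<le> q (Suc k) \<and> q k \<le> max (q (2 * E)) (G ^ 2) * H ^ (2 * E)"
    unfolding P_def by blast
qed

text \<open>An admissible \<open>w > E\<close> would give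
  \<open>c \<le> H ^ E * H powr (- w - 1) \<le> 1 / H\<close>, which bounds the heights and leaves
  only finitely many approximants. Since heights are at least 1, every approximant satisfies the
  proximity condition in \<open>lower\<close>.\<close>

lemma omega_star_finiteI:
  fixes x c :: real
  assumes c: "c > 0"
    and lower: "\<And>\<beta>. \<lbrakk>algebraic \<beta>; alg_degree \<beta> = n; \<bar>x - \<beta>\<bar> \<le> 1\<rbrakk> \<Longrightarrow> c \<le> of_int (height \<beta>) ^ E * \<bar>x - \<beta>\<bar>"
  shows "omega_star n (of_real x) < \<infinity>"
proof -
  have "w \<le> of_nat E" if w: "w > 0" and inf: "infinite {\<alpha>::real. algebraic \<alpha> \<and> alg_degree \<alpha> = n \<and>
        0 < cmod (of_real x - of_real \<alpha>) \<and>
        cmod (of_real x - of_real \<alpha>) < real_of_int (height \<alpha>) powr (- w - 1)}" (is "infinite ?S") for w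
  proof (rule ccontr)
    assume "\<not> w \<le> of_nat E"
    hence wE: "real E < w" by simp
    have "?S \<subseteq> {\<alpha>. algebraic \<alpha> \<and> alg_degree \<alpha> = n \<and> height \<alpha> \<le> \<lceil>1 / c\<rceil>}"
    proof safe
      fix \<beta> :: real
      assume \<beta>: "algebraic \<beta>" "n = alg_degree \<beta>"
        "cmod (of_real x - of_real \<beta>) < of_int (height \<beta>) powr (- w - 1)"
      define H where "H = real_of_int (height \<beta>)"
      have H: "1 \<le> H" using height_ge_1[OF \<beta>(1)] by (simp add: H_def)
      have lt: "\<bar>x - \<beta>\<bar> < H powr (- w - 1)"
        using \<beta>(3) by (simp add: H_def norm_of_real flip: of_real_diff)
      also have "H powr (- w - 1) \<le> H powr 0" using H w by (intro powr_mono) auto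
      also have "\<dots> = 1" using H by simp
      finally have "c \<le> H ^ E * \<bar>x - \<beta>\<bar>"
        unfolding H_def using \<beta> by (intro lower) auto
      also have "\<dots> \<le> H ^ E * H powr (- w - 1)" using lt H by (intro mult_left_mono) auto
      also have "\<dots> = H powr (real E - w - 1)"
        using H by (simp add: powr_add [symmetric] algebra_simps flip: powr_realpow)
      also have "\<dots> \<le> H powr (- 1)" using H wE by (intro powr_mono) auto
      also have "\<dots> = 1 / H" using H by (simp add: powr_minus_divide)
      finally have "H \<le> 1 / c" using c H by (simp add: field_simps)
      thus "height \<beta> \<le> \<lceil>1 / c\<rceil>" unfolding H_def by linarith
    qed
    thus False using inf finite_bounded_height finite_subset by blast
  qed
  hence "omega_star n (of_real x) \<le> ennreal (of_nat E)"
    unfolding omega_star_def by (intro SUP_least ennreal_leI) auto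
  thus ?thesis by (auto simp: less_top[symmetric] top_unique)
qed

text \<open>The growth condition makes the error at most \<open>2 / q k ^ Suc k\<close>, as for a
  Liouville number. Positive numerators make multiplication by \<open>p k / q k\<close> preserve
  degrees.\<close>

locale liouville_approx =
  fixes p q :: "nat \<Rightarrow> int" and l :: real
  assumes q_ge_2: "2 \<le> q k" and p_pos: "0 < p k" and growth: "q k ^ Suc k \<le> q (Suc k)"
    and approx_pos: "0 < \<bar>l - p k / q k\<bar>" and approx_le: "\<bar>l - p k / q k\<bar> \<le> 2 / q (Suc k)"
begin

lemma abs_approximant_le: "\<bar>p k / q k\<bar> \<le> \<bar>l\<bar> + 1"
proof -
  have "2 / real_of_int (q (Suc k)) \<le> 1" using q_ge_2[of "Suc k"] by simp
  thus ?thesis using approx_le[of k] by linarith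
qed

lemma max_le_q: "real_of_int (max \<bar>p k\<bar> \<bar>q k\<bar>) \<le> (\<bar>l\<bar> + 1) * q k"
proof -
  have "real_of_int \<bar>p k\<bar> \<le> (\<bar>l\<bar> + 1) * q k"
    using abs_approximant_le[of k] q_ge_2[of k] by (simp add: abs_divide divide_le_eq)
  moreover have "real_of_int \<bar>q k\<bar> \<le> (\<bar>l\<bar> + 1) * q k"
    using q_ge_2[of k] by (simp add: algebra_simps)
  ultimately show ?thesis by auto
qed

lemma q_ge_power: "2 ^ k \<le> q k"
proof (cases k)
  case (Suc j)
  have "(2::int) ^ Suc j \<le> q j ^ Suc j" using q_ge_2[of j] by (intro power_mono) auto
  also have "\<dots> \<le> q (Suc j)" by (rule growth)
  finally show ?thesis unfolding Suc .
qed (use q_ge_2[of 0] in simp)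

section \<open>Approximants scaled by an algebraic number\<close>

context
  fixes \<alpha> :: real
  assumes alg: "algebraic \<alpha>" and nz: "\<alpha> \<noteq> 0"
begin

definition approximant :: "nat \<Rightarrow> real" where
  "approximant k = \<alpha> * (of_int (p k) / of_int (q k))"

lemma approximant_algebraic: "algebraic (approximant k)"
  and alg_degree_approximant: "alg_degree (approximant k) = alg_degree \<alpha>"
proof -
  have "p k \<noteq> 0" "q k \<noteq> 0" using p_pos[of k] q_ge_2[of k] by auto
  thus "algebraic (approximant k)" "alg_degree (approximant k) = alg_degree \<alpha>"
    unfolding approximant_def by (rule algebraic_scaled[OF alg] alg_degree_scaled[OF alg])+
qed

lemma height_approximant_le:
  "real_of_int (height (approximant k)) \<le> height \<alpha> * (\<bar>l\<bar> + 1) ^ alg_degree \<alpha> * q k ^ alg_degree \<alpha>"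
proof -
  have "height (approximant k) \<le> height \<alpha> * max \<bar>p k\<bar> \<bar>q k\<bar> ^ alg_degree \<alpha>"
    unfolding approximant_def using alg p_pos[of k] q_ge_2[of k] by (intro height_scaled) auto
  hence "real_of_int (height (approximant k)) \<le> height \<alpha> * real_of_int (max \<bar>p k\<bar> \<bar>q k\<bar>) ^ alg_degree \<alpha>"
    by (metis of_int_le_iff of_int_mult of_int_power)
  also have "\<dots> \<le> height \<alpha> * ((\<bar>l\<bar> + 1) * q k) ^ alg_degree \<alpha>"
    using max_le_q[of k] height_ge_1[OF alg] by (intro mult_left_mono power_mono) auto
  finally show ?thesis by (simp add: power_mult_distrib)
qed

lemma dist_approximant:
  "0 < \<bar>\<alpha> * l - approximant k\<bar>" "\<bar>\<alpha> * l - approximant k\<bar> \<le> 2 * \<bar>\<alpha>\<bar> / q (Suc k)"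
proof -
  have eq: "\<bar>\<alpha> * l - approximant k\<bar> = \<bar>\<alpha>\<bar> * \<bar>l - p k / q k\<bar>"
    by (simp add: approximant_def abs_mult [symmetric] algebra_simps)
  show "0 < \<bar>\<alpha> * l - approximant k\<bar>" unfolding eq using approx_pos[of k] nz by simp
  have "\<bar>\<alpha>\<bar> * \<bar>l - p k / q k\<bar> \<le> \<bar>\<alpha>\<bar> * (2 / q (Suc k))"
    using approx_le[of k] by (intro mult_left_mono) auto
  thus "\<bar>\<alpha> * l - approximant k\<bar> \<le> 2 * \<bar>\<alpha>\<bar> / q (Suc k)" unfolding eq by (simp add: mult.commute)
qed

text \<open>For given \<open>\<beta>\<close>, the index \<open>k\<close> is chosen so that the error
  of \<open>approximant k\<close> is at most half of its guaranteed distance from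
  \<open>\<beta>\<close>; the other half remains between \<open>\<beta>\<close> and
  \<open>\<alpha> * l\<close>.\<close>

lemma omega_star_other_degree_finite:
  assumes n: "n \<noteq> alg_degree \<alpha>"
  shows "omega_star n (of_real (\<alpha> * l)) < \<infinity>"
proof -
  define m where "m = alg_degree \<alpha>"
  define N where "N = m + n"
  \<comment> \<open>The height of an approximant is at most a constant times \<open>q k ^ m\<close>,
    and Liouville's inequality raises it to the power \<open>N\<close>.\<close>
  define E where "E = m * N"
  define A where "A = height \<alpha> * (\<bar>l\<bar> + 1) ^ m"
  \<comment> \<open>Large enough for all approximants and for every \<open>\<beta>\<close> within 1
    of \<open>\<alpha> * l\<close>.\<close>
  define K where "K = \<bar>\<alpha>\<bar> * (\<bar>l\<bar> + 1) + 1"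
  have m: "m > 0" unfolding m_def by (rule alg_degree_pos[OF alg])
  have A: "A \<ge> 1"
  proof -
    have "1 * 1 \<le> height \<alpha> * (\<bar>l\<bar> + 1) ^ m"
      using height_ge_1[OF alg] by (intro mult_mono one_le_power) auto
    thus ?thesis by (simp add: A_def)
  qed
  have K: "K \<ge> 1" by (simp add: K_def)
  obtain C where C: "C \<ge> 1" "\<And>\<alpha> \<beta> M :: real. \<lbrakk>algebraic \<alpha>; alg_degree \<alpha> = m; algebraic \<beta>; alg_degree \<beta> = n;
       \<bar>\<alpha>\<bar> \<le> K; \<bar>\<beta>\<bar> \<le> K; height \<alpha> \<le> M; height \<beta> \<le> M\<rbrakk> \<Longrightarrow> 1 \<le> C * M ^ N * \<bar>\<alpha> - \<beta>\<bar>"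
    using liouville_inequality[of m n K] n K unfolding m_def N_def by metis
  define D where "D = C * A ^ N"
  have D: "D \<ge> 1"
  proof -
    have "1 * 1 \<le> C * A ^ N" using C A by (intro mult_mono one_le_power) auto
    thus ?thesis by (simp add: D_def)
  qed
  \<comment> \<open>The 4 combines the 2 in the error
    \<open>2 * \<bar>\<alpha>\<bar> / q (Suc k)\<close> with the wish for at most one half; the
    maximum gives \<open>G \<ge> 1\<close>.\<close>
  define G where "G = 4 * D * max 1 \<bar>\<alpha>\<bar>"
  have G: "1 \<le> G"
  proof -
    have "1 * 1 \<le> (4 * D) * max 1 \<bar>\<alpha>\<bar>" using D by (intro mult_mono) auto
    thus ?thesis by (simp add: G_def)
  qed
  obtain Q where Q: "1 \<le> Q"
    "\<And>H :: real. 1 \<le> H \<Longrightarrow> \<exists>k. G * (H * q k) ^ E \<le> q (Suc k) \<and> q k \<le> Q * H ^ (2 * E)"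
  proof (rule superexponential_gap[of "\<lambda>k. real_of_int (q k)" G E])
    show "2 \<le> real_of_int (q k)" for k using q_ge_2[of k] by simp
    show "real_of_int (q k) ^ Suc k \<le> q (Suc k)" for k
      using growth[of k] by (metis of_int_le_iff of_int_power)
  qed (use G in auto)
  show ?thesis
  \<comment> \<open>Both parameters come from inserting \<open>q k \<le> Q * H ^ (2 * E)\<close>
    into the lower bound \<open>1 / (2 * D * (H * q k) ^ E)\<close> for the distance.\<close>
  proof (rule omega_star_finiteI[where c = "1 / (2 * D * Q ^ E)" and E = "(2 * E + 1) * E"])
    show "0 < 1 / (2 * D * Q ^ E)" using D Q by simp
    fix \<beta> :: real
    assume \<beta>: "algebraic \<beta>" "alg_degree \<beta> = n" "\<bar>\<alpha> * l - \<beta>\<bar> \<le> 1"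
    define H where "H = real_of_int (height \<beta>)"
    have H: "1 \<le> H" using height_ge_1[OF \<beta>(1)] by (simp add: H_def)
    obtain k where k: "G * (H * q k) ^ E \<le> q (Suc k)" "q k \<le> Q * H ^ (2 * E)"
      using Q(2)[OF H] by blast
    define r where "r = real_of_int (q k)"
    have r: "2 \<le> r" using q_ge_2[of k] by (simp add: r_def)
    have pos: "0 < D * (H * r) ^ E" using D H r by simp
    \<comment> \<open>\<open>A * (H * r ^ m)\<close> dominates the heights of both numbers.\<close>
    have "1 \<le> C * (A * (H * r ^ m)) ^ N * \<bar>approximant k - \<beta>\<bar>"
    proof (rule C(2)[OF approximant_algebraic _ \<beta>(1,2)])
      show "alg_degree (approximant k) = m" by (simp add: alg_degree_approximant m_def)
      show "\<bar>approximant k\<bar> \<le> K"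
        using mult_left_mono[OF abs_approximant_le[of k], of "\<bar>\<alpha>\<bar>"]
        unfolding approximant_def K_def abs_mult by linarith
      have "\<bar>\<alpha> * l\<bar> \<le> \<bar>\<alpha>\<bar> * (\<bar>l\<bar> + 1)" by (simp add: abs_mult algebra_simps)
      thus "\<bar>\<beta>\<bar> \<le> K" using \<beta>(3) unfolding K_def by linarith
      have rm: "1 \<le> r ^ m" using r by (intro one_le_power) auto
      have "real_of_int (height (approximant k)) \<le> A * (1 * r ^ m)"
        using height_approximant_le[of k] by (simp add: A_def m_def r_def)
      also have "\<dots> \<le> A * (H * r ^ m)"
        using H A rm by (intro mult_left_mono mult_right_mono) auto
      finally show "real_of_int (height (approximant k)) \<le> A * (H * r ^ m)" .
      have "1 * (H * 1) \<le> A * (H * r ^ m)"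
        using H A rm by (intro mult_mono) auto
      thus "real_of_int (height \<beta>) \<le> A * (H * r ^ m)" by (simp add: H_def)
    qed
    also have "C * (A * (H * r ^ m)) ^ N = D * (H ^ N * r ^ E)"
      by (simp add: D_def E_def power_mult_distrib flip: power_mult)
    \<comment> \<open>\<open>N \<le> E\<close> because \<open>m > 0\<close>, so \<open>H\<close> can
      be given the same exponent as \<open>r\<close>.\<close>
    also have "\<dots> * \<bar>approximant k - \<beta>\<bar> \<le> D * (H ^ E * r ^ E) * \<bar>approximant k - \<beta>\<bar>"
      using D H r m by (intro mult_right_mono mult_left_mono power_increasing) (auto simp: E_def)
    finally have sep: "1 \<le> D * (H * r) ^ E * \<bar>approximant k - \<beta>\<bar>" by (simp add: power_mult_distrib)
    have "D * (H * r) ^ E * \<bar>\<alpha> * l - approximant k\<bar> \<le> 1 / 2"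
    proof -
      have q0: "0 < real_of_int (q (Suc k))" using q_ge_2[of "Suc k"] by simp
      have "D * (H * r) ^ E * \<bar>\<alpha> * l - approximant k\<bar> \<le> D * (H * r) ^ E * (2 * \<bar>\<alpha>\<bar> / q (Suc k))"
        using dist_approximant(2)[of k] pos by (intro mult_left_mono) auto
      also have "\<dots> = (4 * D * \<bar>\<alpha>\<bar> * (H * r) ^ E) / q (Suc k) / 2" by simp
      also have "\<dots> \<le> 1 / 2"
      proof -
        have "4 * D * \<bar>\<alpha>\<bar> * (H * r) ^ E \<le> G * (H * r) ^ E"
          unfolding G_def using D H r by (intro mult_right_mono mult_left_mono) auto
        also have "\<dots> \<le> q (Suc k)" using k(1) by (simp add: r_def)
        finally show ?thesis using q0 by simp
      qed
      finally show ?thesis .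
    qed
    moreover have "D * (H * r) ^ E * \<bar>approximant k - \<beta>\<bar> \<le>
        D * (H * r) ^ E * (\<bar>\<alpha> * l - approximant k\<bar> + \<bar>\<alpha> * l - \<beta>\<bar>)"
      using pos by (intro mult_left_mono) auto
    ultimately have "1 / 2 \<le> D * (H * r) ^ E * \<bar>\<alpha> * l - \<beta>\<bar>"
      using sep unfolding distrib_left by linarith
    also have "\<dots> \<le> D * (H * (Q * H ^ (2 * E))) ^ E * \<bar>\<alpha> * l - \<beta>\<bar>"
      using k(2) D H r by (intro mult_right_mono mult_left_mono power_mono) (auto simp: r_def)
    also have "H * (Q * H ^ (2 * E)) = Q * H ^ (2 * E + 1)" by simp
    also have "\<dots> ^ E = Q ^ E * H ^ ((2 * E + 1) * E)"
      by (simp only: power_mult_distrib power_mult)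
    finally have "1 / 2 \<le> D * Q ^ E * (H ^ ((2 * E + 1) * E) * \<bar>\<alpha> * l - \<beta>\<bar>)" by (simp add: mult_ac)
    moreover have "0 < D * Q ^ E" using D Q by simp
    ultimately show "1 / (2 * D * Q ^ E) \<le> of_int (height \<beta>) ^ ((2 * E + 1) * E) * \<bar>\<alpha> * l - \<beta>\<bar>"
      unfolding H_def [symmetric] by (simp add: field_simps)
  qed
qed

text \<open>Heights of approximants are at most a constant times a fixed power of
  \<open>q k\<close>, while the error decays like \<open>q k\<close> to the power
  \<open>- Suc k\<close>; so all late approximants are admissible for any given exponent.\<close>

lemma omega_star_same_degree_infinite:
  "omega_star (alg_degree \<alpha>) (of_real (\<alpha> * l)) = \<infinity>"
proof -
  define m where "m = alg_degree \<alpha>"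
  define A where "A = height \<alpha> * (\<bar>l\<bar> + 1) ^ m"
  have A: "A \<ge> 1"
  proof -
    have "1 * 1 \<le> height \<alpha> * (\<bar>l\<bar> + 1) ^ m"
      using height_ge_1[OF alg] by (intro mult_mono one_le_power) auto
    thus ?thesis by (simp add: A_def)
  qed
  define d where "d k = \<bar>\<alpha> * l - approximant k\<bar>" for k
  have d: "0 < d k" "d k \<le> 2 * \<bar>\<alpha>\<bar> / q (Suc k)" for k using dist_approximant[of k] by (auto simp: d_def)
  have d_lim: "d \<longlonglongrightarrow> 0"
  proof (rule tendsto_sandwich[of "\<lambda>_. 0" _ _ "\<lambda>k. 2 * \<bar>\<alpha>\<bar> * (1 / 2) ^ Suc k"])
    have "d k \<le> 2 * \<bar>\<alpha>\<bar> * (1 / 2) ^ Suc k" for k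
    proof -
      have "(2::real) ^ Suc k \<le> q (Suc k)"
        using q_ge_power[of "Suc k"] by (metis of_int_le_iff of_int_numeral of_int_power)
      hence "2 * \<bar>\<alpha>\<bar> / q (Suc k) \<le> 2 * \<bar>\<alpha>\<bar> / 2 ^ Suc k"
        by (intro frac_le) simp_all
      with d(2)[of k] show ?thesis by (simp add: power_one_over)
    qed
    thus "\<forall>\<^sub>F k in sequentially. d k \<le> 2 * \<bar>\<alpha>\<bar> * (1 / 2) ^ Suc k" by simp
    show "(\<lambda>k. 2 * \<bar>\<alpha>\<bar> * (1 / 2) ^ Suc k) \<longlonglongrightarrow> 0"
      by (intro tendsto_mult_right_zero LIMSEQ_Suc LIMSEQ_realpow_zero) auto
  qed (use d in \<open>auto simp: less_imp_le\<close>)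
  have inf: "infinite {\<beta>::real. algebraic \<beta> \<and> alg_degree \<beta> = m \<and>
        0 < cmod (of_real (\<alpha> * l) - of_real \<beta>) \<and>
        cmod (of_real (\<alpha> * l) - of_real \<beta>) < real_of_int (height \<beta>) powr (- w - 1)}" (is "infinite ?S")
    if w: "w > 0" for w
  proof
    assume fin: "finite ?S"
    obtain W :: nat where W: "w + 1 \<le> of_nat W" using real_arch_simple by blast
    \<comment> \<open>\<open>q k ^ j\<close> absorbs the constants and \<open>q k ^ (m * W)\<close>
      the height, whence the threshold \<open>m * W + j\<close>.\<close>
    obtain j where j: "2 * \<bar>\<alpha>\<bar> * A ^ W < 2 ^ j" using real_arch_pow[of 2] by auto
    have mem: "approximant k \<in> ?S" if k: "k \<ge> m * W + j" for k
    proof -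
      define H where "H = real_of_int (height (approximant k))"
      define r where "r = real_of_int (q k)"
      have r: "2 \<le> r" using q_ge_2[of k] by (simp add: r_def)
      have H: "1 \<le> H" using height_ge_1[OF approximant_algebraic] by (simp add: H_def)
      have "H ^ W \<le> (A * r ^ m) ^ W"
        using height_approximant_le[of k] H by (intro power_mono) (auto simp: H_def A_def r_def m_def)
      hence "2 * \<bar>\<alpha>\<bar> * H ^ W \<le> 2 * \<bar>\<alpha>\<bar> * (A * r ^ m) ^ W" by (intro mult_left_mono) auto
      also have "\<dots> = (2 * \<bar>\<alpha>\<bar> * A ^ W) * r ^ (m * W)"
        by (simp add: power_mult_distrib flip: power_mult)
      also have "\<dots> < 2 ^ j * r ^ (m * W)" using j r by (intro mult_strict_right_mono) auto
      also have "\<dots> \<le> r ^ j * r ^ (m * W)" using r by (intro mult_right_mono power_mono) auto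
      also have "\<dots> = r ^ (m * W + j)" by (simp add: power_add)
      also have "\<dots> \<le> r ^ Suc k" using r k by (intro power_increasing) auto
      also have "\<dots> \<le> q (Suc k)" using growth[of k] unfolding r_def by (metis of_int_le_iff of_int_power)
      finally have lt: "2 * \<bar>\<alpha>\<bar> * H ^ W < q (Suc k)" .
      have "d k \<le> 2 * \<bar>\<alpha>\<bar> / q (Suc k)" by (rule d)
      also have "\<dots> < 1 / H ^ W" using lt H q_ge_2[of "Suc k"] by (simp add: field_simps)
      also have "\<dots> = H powr (- real W)" using H by (simp add: powr_minus_divide powr_realpow)
      also have "\<dots> \<le> H powr (- w - 1)" using H W by (intro powr_mono) auto
      finally have "d k < H powr (- w - 1)" .
      with d(1)[of k] show ?thesis
        unfolding d_def H_def
        by (simp add: approximant_algebraic alg_degree_approximant m_def norm_of_real flip: of_real_mult of_real_diff)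
    qed
    \<comment> \<open>Finitely many approximants would have a positive least distance from
      \<open>\<alpha> * l\<close>, but the distances tend to 0.\<close>
    let ?D = "(\<lambda>\<beta>. \<bar>\<alpha> * l - \<beta>\<bar>) ` approximant ` {m * W + j..}"
    have "approximant ` {m * W + j..} \<subseteq> ?S" using mem by blast
    hence finD: "finite ?D" using fin by (blast intro: finite_subset finite_imageI)
    have "Min ?D \<in> ?D" using finD by (intro Min_in) auto
    hence "0 < Min ?D" using d(1) by (auto simp: d_def)
    hence "\<forall>\<^sub>F k in sequentially. d k < Min ?D" by (rule order_tendstoD[OF d_lim])
    then obtain k where k: "k \<ge> m * W + j" "d k < Min ?D"
      by (metis eventually_sequentially nat_le_linear)
    have "Min ?D \<le> d k" using finD k(1) by (intro Min_le) (auto simp: d_def)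
    with k show False by simp
  qed
  have ge: "omega_star m (of_real (\<alpha> * l)) \<ge> ennreal (of_nat N)" for N
  proof -
    \<comment> \<open>\<open>Suc N\<close> instead of \<open>N\<close>, since admissible exponents
      are positive.\<close>
    have "ennreal (of_nat N) \<le> ennreal (of_nat (Suc N))" by (intro ennreal_leI) auto
    also have "\<dots> \<le> omega_star m (of_real (\<alpha> * l))"
      unfolding omega_star_def by (rule SUP_upper) (use inf[of "of_nat (Suc N)"] in auto)
    finally show ?thesis .
  qed
  have "omega_star m (of_real (\<alpha> * l)) = \<infinity>"
  proof (rule ccontr)
    assume "omega_star m (of_real (\<alpha> * l)) \<noteq> \<infinity>"
    then obtain N where "omega_star m (of_real (\<alpha> * l)) < of_nat N"
      using ennreal_Ex_less_of_nat by (auto simp: less_top)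
    with ge[of N] show False by (simp add: ennreal_of_nat_eq_real_of_nat)
  qed
  thus ?thesis by (simp add: m_def)
qed

lemma U_number_mult: "of_real (\<alpha> * l) \<in> U_numbers (alg_degree \<alpha>)"
  using alg_degree_pos[OF alg] omega_star_same_degree_infinite omega_star_other_degree_finite
  unfolding U_numbers_def by (auto simp: Suc_le_eq)

end

end

subsection \<open>Liouville constants times roots of 2\<close>

text \<open>The induction behind Eisenstein's criterion: in the convolution for
  \<open>coeff p i\<close> all terms but \<open>coeff b i * coeff g 0\<close> are already divisible
  by \<open>r\<close>.\<close>

lemma eisenstein_dvd_coeff:
  fixes p b g :: "int poly" and r :: int
  assumes pbg: "p = b * g" and r: "prime r" and g0: "\<not> r dvd coeff g 0"
    and p: "\<And>i. i < m \<Longrightarrow> r dvd coeff p i"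
  shows "i < m \<Longrightarrow> r dvd coeff b i"
proof (induction i rule: less_induct)
  case (less i)
  have "coeff p i = (\<Sum>j<i. coeff b j * coeff g (i - j)) + coeff b i * coeff g 0"
    unfolding pbg coeff_mult by (simp flip: lessThan_Suc_atMost)
  moreover have "r dvd (\<Sum>j<i. coeff b j * coeff g (i - j))"
    using less by (intro dvd_sum dvd_mult2) auto
  ultimately have "r dvd coeff b i * coeff g 0" using p[OF less.prems] by (simp add: dvd_add_right_iff)
  thus "r dvd coeff b i" using r g0 by (simp add: prime_dvd_mult_iff)
qed

text \<open>Eisenstein's criterion at 2 for \<open>X ^ m - 2\<close>, applied to the cofactor
  \<open>g\<close> of the minimal polynomial \<open>b\<close>; both leading coefficients are odd
  because their product is 1.\<close>

lemma root_2:
  assumes m: "m \<ge> 1"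
  shows algebraic_root_2: "algebraic (root m 2)" and alg_degree_root_2: "alg_degree (root m 2) = m"
proof -
  show alg: "algebraic (root m 2)" by auto
  define p :: "int poly" where "p = monom 1 m - [:2:]"
  have coeff_p: "coeff p i = (if i = m then 1 else 0) - (if i = 0 then 2 else 0)" for i
    by (simp add: p_def coeff_pCons split: nat.split)
  have root: "poly (of_int_poly p) (root m 2) = 0"
    using m by (simp add: p_def of_int_poly_hom.hom_minus poly_monom)
  define b where "b = min_int_poly (root m 2)"
  obtain g where g: "p = b * g"
    using min_int_poly_dvd[OF alg root] unfolding b_def by blast
  have p0: "p \<noteq> 0" using coeff_p[of m] m by auto
  have deg_p: "degree p = m"
    by (intro order.antisym degree_le le_degree) (use m in \<open>auto simp: coeff_p\<close>)
  have deg: "degree b + degree g = m"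
    using p0 deg_p unfolding g by (auto simp: degree_mult_eq)
  have b_pos: "degree b > 0"
    using alg_degree_pos[OF alg] by (simp add: alg_degree_def b_def)
  have "lead_coeff p = 1" using coeff_p[of m] m deg_p by simp
  hence lead: "lead_coeff b * lead_coeff g = 1" by (simp add: g lead_coeff_mult)
  hence odd: "odd (lead_coeff b)" "odd (lead_coeff g)" by (metis dvd_mult2 dvd_mult odd_one)+
  have even_p: "even (coeff p i)" if "i < m" for i using that by (simp add: coeff_p)
  have const: "coeff b 0 * coeff g 0 = -2"
    using coeff_p[of 0] m by (simp add: g coeff_mult_0)
  have "\<not> (even (coeff b 0) \<and> even (coeff g 0))"
  proof
    assume "even (coeff b 0) \<and> even (coeff g 0)"
    hence "2 * 2 dvd coeff b 0 * coeff g 0" by (intro mult_dvd_mono) auto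
    thus False by (simp add: const)
  qed
  \<comment> \<open>Were it odd, the roles of \<open>b\<close> and \<open>g\<close> could be
    exchanged; \<open>degree g < m\<close>, so the leading coefficient of \<open>g\<close> would be
    even.\<close>
  moreover have "even (coeff b 0)"
  proof (rule ccontr)
    assume "odd (coeff b 0)"
    hence "even (coeff g (degree g))"
      using eisenstein_dvd_coeff[of p g b 2 m "degree g"] even_p deg b_pos g by (simp add: mult.commute)
    thus False using odd by simp
  qed
  ultimately have "odd (coeff g 0)" by blast
  hence "\<not> degree b < m"
    using eisenstein_dvd_coeff[of p b g 2 m "degree b"] even_p odd g by auto
  thus "alg_degree (root m 2) = m" using deg by (simp add: alg_degree_def b_def)
qed

section \<open>Tails of Liouville's series in base 2\<close>

definition liouville_const :: "nat \<Rightarrow> real" where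
  "liouville_const j = (\<Sum>k. 1 / 2 ^ fact (k + j))"

text \<open>The source of the geometric bounds below. It fails for \<open>n = 0\<close> because
  \<open>0! = 1!\<close>, hence the restriction to positive indices there.\<close>

lemma fact_add_le: "n \<ge> 1 \<Longrightarrow> fact n + i \<le> (fact (n + i) :: nat)"
proof (induction i)
  case (Suc i)
  have "1 \<le> (n + i) * (fact (n + i) :: nat)" using Suc.prems by simp
  moreover have "fact (n + Suc i) = fact (n + i) + (n + i) * (fact (n + i) :: nat)" by simp
  ultimately show ?case using Suc.IH[OF Suc.prems] by linarith
qed simp

lemma liouville_term_le:
  assumes "n \<ge> 1"
  shows "1 / 2 ^ fact (n + i) \<le> (1 / 2 ^ fact n :: real) * (1 / 2) ^ i"
proof -
  have "(2::real) ^ (fact n + i) \<le> 2 ^ fact (n + i)"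
    using fact_add_le[OF assms, of i] by (intro power_increasing) auto
  thus ?thesis by (simp add: power_add power_one_over field_simps)
qed

lemma summable_liouville: "summable (\<lambda>k. 1 / 2 ^ fact (k + j) :: real)"
proof -
  \<comment> \<open>The first term is dropped so that the comparison starts at a positive index even
    for \<open>j = 0\<close>.\<close>
  have "summable (\<lambda>i. (1 / 2 ^ fact (Suc j) :: real) * (1 / 2) ^ i)"
    by (intro summable_mult summable_geometric) auto
  hence "summable (\<lambda>k. 1 / 2 ^ fact (Suc k + j) :: real)"
  proof (rule summable_comparison_test'[where N = 0])
    show "norm (1 / 2 ^ fact (Suc k + j) :: real) \<le> (1 / 2 ^ fact (Suc j)) * (1 / 2) ^ k" for k
      using liouville_term_le[of "Suc j" k] by (simp add: add.commute del: fact_Suc)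
  qed
  thus ?thesis using summable_Suc_iff[of "\<lambda>k. 1 / 2 ^ fact (k + j) :: real"] by simp
qed

lemma liouville_const_split:
  "liouville_const j = (\<Sum>i<n. 1 / 2 ^ fact (i + j)) + liouville_const (n + j)"
  unfolding liouville_const_def
  by (subst suminf_split_initial_segment[OF summable_liouville, of _ n]) (simp add: add_ac)

lemma liouville_const_pos: "0 < liouville_const j"
  unfolding liouville_const_def by (intro suminf_pos summable_liouville) auto

lemma liouville_const_le:
  assumes "j \<ge> 1"
  shows "liouville_const j \<le> 2 / 2 ^ fact j"
proof -
  have "liouville_const j \<le> (\<Sum>i. (1 / 2 ^ fact j :: real) * (1 / 2) ^ i)"
    unfolding liouville_const_def
    using liouville_term_le[OF assms]
    by (intro suminf_le summable_liouville summable_mult summable_geometric) (auto simp: add.commute)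
  also have "\<dots> = (1 / 2 ^ fact j) * 2" by (subst suminf_mult) (auto simp: suminf_geometric)
  finally show ?thesis by simp
qed

lemma liouville_const_antimono: "i \<le> j \<Longrightarrow> liouville_const j \<le> liouville_const i"
  using liouville_const_split[of i "j - i"] by (simp add: sum_nonneg)

lemma inj_liouville_const: "inj liouville_const"
proof (rule linorder_injI)
  fix i j :: nat assume "i < j"
  hence "liouville_const j \<le> liouville_const (Suc i)" by (intro liouville_const_antimono) auto
  moreover have "liouville_const i = 1 / 2 ^ fact i + liouville_const (Suc i)"
    using liouville_const_split[of i 1] by simp
  ultimately show "liouville_const i \<noteq> liouville_const j"
    by (simp add: add_pos_nonneg) (smt (verit) divide_pos_pos zero_less_power)
qed

text \<open>The approximants are partial sums over the common denominator
  \<open>2 ^ fact (k + j)\<close>, and the error is the next tail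
  \<open>liouville_const (Suc k + j)\<close>.\<close>

lemma liouville_approx_const:
  "liouville_approx (\<lambda>k. \<Sum>i\<le>k. 2 ^ (fact (k + j) - fact (i + j))) (\<lambda>k. 2 ^ fact (k + j)) (liouville_const j)"
proof
  fix k :: nat
  show "(2::int) \<le> 2 ^ fact (k + j)"
    using power_increasing[of 1 "fact (k + j)" "2::int"] by (simp add: fact_ge_1)
  show "(0::int) < (\<Sum>i\<le>k. 2 ^ (fact (k + j) - fact (i + j)))"
    by (intro sum_pos) auto
  have "fact (k + j) * Suc k \<le> fact (Suc k + j)" by simp
  thus "((2::int) ^ fact (k + j)) ^ Suc k \<le> 2 ^ fact (Suc k + j)"
    unfolding power_mult [symmetric] by (intro power_increasing) auto
  have "real_of_int (\<Sum>i\<le>k. 2 ^ (fact (k + j) - fact (i + j))) / real_of_int (2 ^ fact (k + j)) =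
      (\<Sum>i\<le>k. 1 / 2 ^ fact (i + j))"
    unfolding of_int_sum sum_divide_distrib
  proof (rule sum.cong)
    fix i assume "i \<in> {..k}"
    hence "fact (i + j) \<le> (fact (k + j) :: nat)" by (intro fact_mono) auto
    hence "(2::real) ^ (fact (k + j) - fact (i + j)) = 2 ^ fact (k + j) / 2 ^ fact (i + j)"
      by (simp add: power_diff)
    thus "real_of_int (2 ^ (fact (k + j) - fact (i + j))) / real_of_int (2 ^ fact (k + j)) =
        1 / 2 ^ fact (i + j)" by simp
  qed simp
  hence eq: "\<bar>liouville_const j - real_of_int (\<Sum>i\<le>k. 2 ^ (fact (k + j) - fact (i + j))) / real_of_int (2 ^ fact (k + j))\<bar> =
      liouville_const (Suc k + j)"
    using liouville_const_split[of j "Suc k"] liouville_const_pos[of "Suc k + j"]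
    by (simp add: lessThan_Suc_atMost)
  show "0 < \<bar>liouville_const j - real_of_int (\<Sum>i\<le>k. 2 ^ (fact (k + j) - fact (i + j))) / real_of_int (2 ^ fact (k + j))\<bar>"
    unfolding eq by (rule liouville_const_pos)
  show "\<bar>liouville_const j - real_of_int (\<Sum>i\<le>k. 2 ^ (fact (k + j) - fact (i + j))) / real_of_int (2 ^ fact (k + j))\<bar>
      \<le> 2 / real_of_int (2 ^ fact (Suc k + j))"
    unfolding eq using liouville_const_le[of "Suc k + j"] by simp
qed

lemma root_2_liouville_U_number:
  assumes "m \<ge> 1"
  shows "of_real (root m 2 * liouville_const j) \<in> U_numbers m"
  using liouville_approx.U_number_mult[OF liouville_approx_const algebraic_root_2[OF assms]]
    alg_degree_root_2[OF assms] assms by simp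

section \<open>Values of \<open>psi\<close> and divergence\<close>

lemma algebraic_root_quotient:
  assumes "m \<ge> 1" "s \<ge> 1"
  shows "algebraic (complex_of_real (root s 2 / root m 2))"
proof (rule algebraic_root)
  have pow: "root n 2 ^ (n * k) = (2::real) ^ k" if "n \<ge> 1" for n k
    using that by (simp add: power_mult)
  \<comment> \<open>The exponent \<open>m * s\<close> clears both roots and leaves a rational
    number.\<close>
  have "(root s 2 / root m 2) ^ (m * s) = (2 ^ m / 2 ^ s :: real)"
    using pow[of s m] pow[of m s] assms by (simp add: power_divide mult.commute)
  from arg_cong[OF this, of complex_of_real]
  show "poly (monom 1 (m * s)) (complex_of_real (root s 2 / root m 2)) = of_real (2 ^ m / 2 ^ s)"
    by (simp add: poly_monom)
  show "algebraic (complex_of_real (2 ^ m / 2 ^ s))"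
    by (intro rat_imp_algebraic) (simp add: Rats_divide)
qed (use assms in \<open>auto simp: degree_monom_eq\<close>)

lemma psi_root_2_liouville:
  assumes "m \<ge> 1" "s \<ge> 1"
  shows "\<exists>F. psi m (of_real (root m 2 * liouville_const j), F) = Some s"
proof (intro exI)
  let ?F = "Fract [:0, complex_of_real (root s 2 / root m 2):] 1"
  have "?F \<in> alg_ratfuns"
    unfolding alg_ratfuns_def using algebraic_root_quotient[OF assms]
    by (auto simp: coeff_pCons split: nat.split intro!: exI)
  moreover have eval: "ratfun_eval ?F (of_real (root m 2 * liouville_const j)) =
      of_real (root s 2 * liouville_const j)"
    using assms by (subst ratfun_eval_Fract) auto
  ultimately show "psi m (of_real (root m 2 * liouville_const j), ?F) = Some s"
    using root_2_liouville_U_number[OF assms(1), of j] root_2_liouville_U_number[OF assms(2), of j] assms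
    by (auto simp: psi_def is_U_number_def U_type_eq eval)
qed

text \<open>Unconditional summability passes to the subset \<open>range f\<close> and, by
  injectivity, to a series over the naturals whose terms have modulus at least
  \<open>1 / B\<close>.\<close>

lemma not_summable_on_of_bounded_range:
  fixes f :: "nat \<Rightarrow> complex"
  assumes "inj f" "range f \<subseteq> A" "\<And>j. f j \<noteq> 0" "\<And>j. cmod (f j) \<le> B"
  shows "\<not> (\<lambda>\<xi>. 1 / \<xi>) summable_on A"
proof
  assume "(\<lambda>\<xi>. 1 / \<xi>) summable_on A"
  hence "(\<lambda>\<xi>. 1 / \<xi>) summable_on range f" using assms(2) by (rule summable_on_subset_banach)
  hence "(\<lambda>j. 1 / f j) summable_on UNIV" using assms(1) by (simp add: summable_on_reindex o_def)
  hence "summable (\<lambda>j. 1 / f j)" by (rule summable_on_imp_summable)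
  hence "(\<lambda>j. 1 / f j) \<longlonglongrightarrow> 0" by (rule summable_LIMSEQ_zero)
  hence lim: "(\<lambda>j. norm (1 / f j)) \<longlonglongrightarrow> 0" by (rule tendsto_norm_zero)
  have B: "0 < B" using assms(3,4)[of 0] by (meson less_le_trans zero_less_norm_iff)
  have "1 / B \<le> norm (1 / f j)" for j
    using assms(3,4)[of j] B by (simp add: norm_divide frac_le)
  hence "1 / B \<le> 0" by (intro LIMSEQ_le_const[OF lim]) auto
  with B show False by simp
qed

theorem corollary3:
  fixes m :: nat
  assumes "m \<ge> 1"
  shows "(\<forall>s\<ge>1. infinite (psi m -` {Some s})) \<and>
         ran (psi m) = {1..} \<and>
         (\<forall>s\<ge>1. \<not> (\<lambda>\<xi>. 1 / \<xi>) summable_on (fst ` (psi m -` {Some s})))"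
proof (intro conjI allI impI)
  define f where "f j = complex_of_real (root m 2 * liouville_const j)" for j
  have inj: "inj f"
    using inj_liouville_const assms by (auto simp: f_def inj_on_def)
  have sub: "range f \<subseteq> fst ` (psi m -` {Some s})" if s: "s \<ge> 1" for s
  proof safe
    fix j
    obtain F where "psi m (f j, F) = Some s"
      using psi_root_2_liouville[OF assms s, of j] unfolding f_def by blast
    thus "f j \<in> fst ` (psi m -` {Some s})" by (intro image_eqI[of _ _ "(f j, F)"]) auto
  qed
  show "infinite (psi m -` {Some s})" if s: "s \<ge> 1" for s
    \<comment> \<open>A finite fibre would have a finite projection, yet the projection contains
      \<open>range f\<close>.\<close>
    using range_inj_infinite[OF inj] sub[OF s] by (meson finite_imageI finite_subset)
  show "\<not> (\<lambda>\<xi>. 1 / \<xi>) summable_on (fst ` (psi m -` {Some s}))" if s: "s \<ge> 1" for s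
  proof (rule not_summable_on_of_bounded_range[OF inj sub[OF s]])
    show "f j \<noteq> 0" for j using assms liouville_const_pos[of j] by (simp add: f_def)
    show "cmod (f j) \<le> root m 2 * liouville_const 0" for j
      using assms liouville_const_pos[of j] liouville_const_antimono[of 0 j]
      unfolding f_def norm_of_real abs_mult by (simp add: mult_left_mono)
  qed
  show "ran (psi m) = {1..}"
  proof
    show "ran (psi m) \<subseteq> {1..}"
      by (auto simp: ran_def psi_def is_U_number_def U_type_eq split: if_splits)
    show "{1..} \<subseteq> ran (psi m)"
    proof
      fix s :: nat assume "s \<in> {1..}"
      then obtain F where "psi m (f 0, F) = Some s"
        using psi_root_2_liouville[OF assms, of s 0] unfolding f_def by auto
      thus "s \<in> ran (psi m)" by (rule ranI)
    qed
  qed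
qed

end
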